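(* Let $S$ be a locally finite space satisfying Axioms 1 and 3. Then $S$ satisfies Axiom 4, i.e. $Fr(Fr(T,S),S)=Fr(T,S)$ for every subset $T\subset S$, if and only if the bounding relation $B$ of $S$ is transitive.
   Context: A locally finite (LF) space is a nonempty set $S$ such that to each element $e\in S$ certain finite subsets of $S$ are assigned as neighborhoods of $e$ (at least one for each $e$). Axiom 1: each neighborhood of $e$ contains $e$, and the intersection of two neighborhoods of $e$ is again a neighborhood of $e$. Hence each $e$ has a smallest neighborhood $SN(e)$, the intersection of all its neighborhoods. Frontier: for $T\subseteq S$, $Fr(T,S)$ is the set of all $e\in S$ such that $SN(e)$ contains elements of both $T$ and $S\setminus T$ (so $Fr(\emptyset,S)=\emptyset$). Axiom 3: the frontier of every subset $T\subset S$ is thin, i.e. there is no pair $a,b\in Fr(T,S)$ with $a\in SN(b)$, $b\in SN(a)$, one of them in $T$ and the other in $S\setminus T$. Bounding relation: $aBb$ ("$a$ bounds $b$") iff $a\neq b$ and $b\in SN(a)$. *)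

theory Defs
  imports Main
begin

text \<open>
  \<^term>\<open>N e\<close> is the family of sets assigned to \<^term>\<open>e\<close> as its neighborhoods; the values of
  \<^term>\<open>N\<close> outside the carrier \<^term>\<open>S\<close> are irrelevant.
\<close>

definition lf_space :: "'a set \<Rightarrow> ('a \<Rightarrow> 'a set set) \<Rightarrow> bool" where
  "lf_space S N \<longleftrightarrow>
     S \<noteq> {} \<and> (\<forall>e\<in>S. N e \<noteq> {} \<and> (\<forall>U\<in>N e. finite U \<and> U \<subseteq> S))"

definition axiom1 :: "'a set \<Rightarrow> ('a \<Rightarrow> 'a set set) \<Rightarrow> bool" where
  "axiom1 S N \<longleftrightarrow>
     (\<forall>e\<in>S. (\<forall>U\<in>N e. e \<in> U) \<and> (\<forall>U\<in>N e. \<forall>V\<in>N e. U \<inter> V \<in> N e))"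

definition SN :: "('a \<Rightarrow> 'a set set) \<Rightarrow> 'a \<Rightarrow> 'a set" where
  "SN N e = \<Inter> (N e)"

definition Fr :: "('a \<Rightarrow> 'a set set) \<Rightarrow> 'a set \<Rightarrow> 'a set \<Rightarrow> 'a set" where
  "Fr N T S = {e \<in> S. SN N e \<inter> T \<noteq> {} \<and> SN N e \<inter> (S - T) \<noteq> {}}"

definition thin_frontier :: "('a \<Rightarrow> 'a set set) \<Rightarrow> 'a set \<Rightarrow> 'a set \<Rightarrow> bool" where
  "thin_frontier N T S \<longleftrightarrow>
     \<not> (\<exists>a\<in>Fr N T S. \<exists>b\<in>Fr N T S. a \<in> SN N b \<and> b \<in> SN N a \<and> a \<in> T \<and> b \<in> S - T)"

definition axiom3 :: "'a set \<Rightarrow> ('a \<Rightarrow> 'a set set) \<Rightarrow> bool" where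
  "axiom3 S N \<longleftrightarrow> (\<forall>T\<subseteq>S. thin_frontier N T S)"

definition axiom4 :: "'a set \<Rightarrow> ('a \<Rightarrow> 'a set set) \<Rightarrow> bool" where
  "axiom4 S N \<longleftrightarrow> (\<forall>T\<subseteq>S. Fr N (Fr N T S) S = Fr N T S)"

definition bounds :: "('a \<Rightarrow> 'a set set) \<Rightarrow> 'a \<Rightarrow> 'a \<Rightarrow> bool" where
  "bounds N a b \<longleftrightarrow> a \<noteq> b \<and> b \<in> SN N a"

end

(* Axiom 3, applied to singletons, makes B asymmetric.  If B is transitive, then SN(x) is
   contained in SN(e) for every x in SN(e), which gives Fr(Fr T) within Fr T; for the converse
   inclusion, finiteness provides an m in SN(e) with SN(m) = {m}, and such an m lies in no
   frontier.  If transitivity fails, say a B b B c but not a B c, then T = {c} violates Axiom 4: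
   b lies in Fr {c} and a does not, so a lies in Fr(Fr {c}). *)
theory Submission
  imports Defs
begin

lemma SN_self:
  assumes "axiom1 S N" and "e \<in> S"
  shows "e \<in> SN N e"
  using assms unfolding axiom1_def SN_def by blast

lemma SN_subset:
  assumes "lf_space S N" and "e \<in> S"
  shows "SN N e \<subseteq> S"
  using assms unfolding lf_space_def SN_def by blast

lemma finite_SN:
  assumes "lf_space S N" and "e \<in> S"
  shows "finite (SN N e)"
proof -
  obtain U where "U \<in> N e" "finite U"
    using assms unfolding lf_space_def by blast
  then show ?thesis
    unfolding SN_def by (meson Inter_lower finite_subset)
qed

text \<open>If \<open>a\<close> and \<open>b\<close> were distinct, both smallest neighborhoods
  would contain both points, so \<open>a\<close> and \<open>b\<close> would form a forbidden pair on
  opposite sides of the frontier of \<open>{a}\<close>.\<close>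

lemma SN_antisym:
  assumes "axiom1 S N" and "axiom3 S N" and "a \<in> S" "b \<in> S"
    and "a \<in> SN N b" "b \<in> SN N a"
  shows "a = b"
proof (rule ccontr)
  assume "a \<noteq> b"
  have "a \<in> SN N a" "b \<in> SN N b"
    using SN_self[OF assms(1)] assms(3,4) by blast+
  then have "a \<in> Fr N {a} S" "b \<in> Fr N {a} S"
    using assms(3-6) \<open>a \<noteq> b\<close> unfolding Fr_def by auto
  moreover have "thin_frontier N {a} S"
    using assms(2,3) unfolding axiom3_def by simp
  ultimately show False
    using assms(4-6) \<open>a \<noteq> b\<close> unfolding thin_frontier_def by blast
qed

lemma SN_mono:
  assumes "lf_space S N" and "transp_on S (bounds N)"
    and "e \<in> S" "x \<in> SN N e"
  shows "SN N x \<subseteq> SN N e"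
proof
  fix y assume y: "y \<in> SN N x"
  have "x \<in> S" "y \<in> S"
    using SN_subset[OF assms(1)] assms(3,4) y by blast+
  \<comment> \<open>As \<open>bounds\<close> is irreflexive, transitivity speaks only of the case
    where \<open>x\<close> differs from both \<open>e\<close> and \<open>y\<close>; if
    \<open>x = e\<close> or \<open>x = y\<close>, the claim is already among the facts.\<close>
  then show "y \<in> SN N e"
    using assms(3,4) y transp_onD[OF assms(2), of e x y] unfolding bounds_def by blast
qed

lemma ex_SN_singleton:
  assumes "lf_space S N" and "axiom1 S N" and "axiom3 S N"
    and "transp_on S (bounds N)" and "e \<in> S"
  obtains m where "m \<in> SN N e" "SN N m = {m}"
proof -
  \<comment> \<open>\<open>m\<close> is chosen in \<open>SN N e\<close> with \<open>SN N m\<close>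
    of least cardinality.\<close>
  obtain m where m: "m \<in> SN N e" and least: "\<And>x. x \<in> SN N e \<Longrightarrow> card (SN N m) \<le> card (SN N x)"
    using ex_has_least_nat[of "\<lambda>x. x \<in> SN N e" e "\<lambda>x. card (SN N x)", OF SN_self[OF assms(2,5)]] by blast
  have mS: "m \<in> S"
    using m SN_subset[OF assms(1,5)] by blast
  have "y = m" if y: "y \<in> SN N m" for y
  proof (rule ccontr)
    assume "y \<noteq> m"
    have yS: "y \<in> S"
      using y SN_subset[OF assms(1) mS] by blast
    have "m \<notin> SN N y"
      using SN_antisym[OF assms(2,3) mS yS] y \<open>y \<noteq> m\<close> by blast
    \<comment> \<open>The inclusion is strict because \<open>m\<close> itself is missing, so
      \<open>y\<close> would undercut the minimal choice of \<open>m\<close>.\<close>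
    then have "SN N y \<subset> SN N m"
      using SN_mono[OF assms(1,4) mS y] SN_self[OF assms(2) mS] by blast
    then have "card (SN N y) < card (SN N m)"
      by (rule psubset_card_mono[OF finite_SN[OF assms(1) mS]])
    moreover have "y \<in> SN N e"
      using SN_mono[OF assms(1,4,5) m] y by blast
    ultimately show False
      using least by fastforce
  qed
  then have "SN N m = {m}"
    using SN_self[OF assms(2) mS] by blast
  with m show thesis
    by (rule that)
qed

lemma axiom4_imp_transp_on_bounds:
  assumes "axiom1 S N" and "axiom3 S N" and "axiom4 S N"
  shows "transp_on S (bounds N)"
proof (rule transp_onI)
  fix a b c
  assume S: "a \<in> S" "b \<in> S" "c \<in> S" and ab: "bounds N a b" and bc: "bounds N b c"
  \<comment> \<open>With \<open>a = c\<close>, the points \<open>a\<close> and \<open>b\<close>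
    would bound each other.\<close>
  have "a \<noteq> c"
    using SN_antisym[OF assms(1,2) S(1,2)] ab bc unfolding bounds_def by blast
  moreover have "c \<in> SN N a"
  proof (rule ccontr)
    assume "c \<notin> SN N a"
    then have a: "a \<notin> Fr N {c} S"
      unfolding Fr_def by blast
    have "b \<in> Fr N {c} S"
      using S bc SN_self[OF assms(1) S(2)] unfolding Fr_def bounds_def by blast
    \<comment> \<open>\<open>SN N a\<close> contains \<open>b\<close> inside
      \<open>Fr N {c} S\<close> and \<open>a\<close> itself outside it.\<close>
    then have "a \<in> Fr N (Fr N {c} S) S"
      using a S(1) ab SN_self[OF assms(1) S(1)] unfolding Fr_def[of N "Fr N {c} S"] bounds_def
      by blast
    then show False
      using a assms(3) S(3) unfolding axiom4_def by simp
  qed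
  ultimately show "bounds N a c"
    unfolding bounds_def by simp
qed

lemma transp_on_bounds_imp_axiom4:
  assumes "lf_space S N" and "axiom1 S N" and "axiom3 S N" and "transp_on S (bounds N)"
  shows "axiom4 S N"
  unfolding axiom4_def
proof (intro allI impI subset_antisym subsetI)
  fix T e assume "e \<in> Fr N (Fr N T S) S"
  then obtain x where "e \<in> S" "x \<in> SN N e" "x \<in> Fr N T S"
    unfolding Fr_def[of N "Fr N T S"] by blast
  \<comment> \<open>\<open>SN N x\<close> meets both \<open>T\<close> and its complement, hence so
    does the larger set \<open>SN N e\<close>.\<close>
  then show "e \<in> Fr N T S"
    using SN_mono[OF assms(1,4)] unfolding Fr_def by blast
next
  fix T e assume e: "e \<in> Fr N T S"
  then have eS: "e \<in> S"
    unfolding Fr_def by simp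
  obtain m where m: "m \<in> SN N e" "SN N m = {m}"
    using ex_SN_singleton[OF assms eS] .
  \<comment> \<open>A one-point set cannot meet both \<open>T\<close> and
    \<open>S - T\<close>.\<close>
  have "m \<in> S - Fr N T S"
    using m SN_subset[OF assms(1) eS] unfolding Fr_def by auto
  then show "e \<in> Fr N (Fr N T S) S"
    using e eS m(1) SN_self[OF assms(2) eS] unfolding Fr_def[of N "Fr N T S"] by blast
qed

theorem mainTheorem3:
  fixes S :: "'a set" and N :: "'a \<Rightarrow> 'a set set"
  assumes "lf_space S N" and "axiom1 S N" and "axiom3 S N"
  shows "axiom4 S N \<longleftrightarrow> transp_on S (bounds N)"
  using axiom4_imp_transp_on_bounds[OF assms(2,3)] transp_on_bounds_imp_axiom4[OF assms] by (rule iffI)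

end
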